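(* Let $q=p^e>4$, where $p$ is a prime, and let $\ell$ be a positive integer with $2\ell\mid e$. Let $n=t\frac{q-1}{p^\ell-1}$ with $1\le t\le p^\ell-1$, and let $s\ge1$. Then, for every integer $k$ with $s+1\le k\le\left\lfloor\frac{p^\ell+n}{p^\ell+1}\right\rfloor$ and every integer $h$ with $0\le h\le k-s-1$, there exists an $[n+s,k]_q$ generalized Roth-Lempel code $C$ such that $\dim\bigl(\operatorname{Hull}_{\ell}(C)\bigr)=h$.
   Context: For $q=p^e$ and $0\le\ell\le e-1$, the $\ell$-Galois inner product on $\mathbb F_q^N$ is $\langle\boldsymbol x,\boldsymbol y\rangle_\ell=\sum_i x_iy_i^{p^\ell}$. For a linear code $C\subseteq\mathbb F_q^N$, $C^{\perp_\ell}=\{\boldsymbol x\in\mathbb F_q^N:\langle\boldsymbol c,\boldsymbol x\rangle_\ell=0\ \text{for all }\boldsymbol c\in C\}$ and $\operatorname{Hull}_\ell(C)=C\cap C^{\perp_\ell}$. An $[n+s,k]_q$ generalized Roth-Lempel (GRL) code, where $1\le s\le k\le n$, is a code of the form $$\operatorname{GRL}_k(\boldsymbol a,\boldsymbol v,A_s)=\{(v_1f(a_1),\ldots,v_nf(a_n),(f_{k-s},\ldots,f_{k-1})A_s): f(x)=\textstyle\sum_{j=0}^{k-1}f_jx^j\in\mathbb F_q[x]\},$$ where $\boldsymbol a\in\mathbb F_q^n$ has pairwise distinct entries, $\boldsymbol v\in(\mathbb F_q^* )^n$ and $A_s\in\operatorname{GL}_s(\mathbb F_q)$. *)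

theory Defs
  imports
    "Jordan_Normal_Form.VS_Connect"
    "HOL-Computational_Algebra.Polynomial"
    "HOL-Computational_Algebra.Primes"
begin

text \<open>For a subspace \<open>C\<close>, the argument of \<open>dim\<close> below is what \<open>vs C\<close> stands for inside the
  locale \<open>vec_space\<close>.\<close>

definition code_dim :: "nat \<Rightarrow> 'a::field vec set \<Rightarrow> nat" where
  "code_dim N C = vectorspace.dim class_ring ((module_vec TYPE('a) N)\<lparr>carrier := C\<rparr>)"

definition linear_code :: "nat \<Rightarrow> nat \<Rightarrow> 'a::field vec set \<Rightarrow> bool" where
  "linear_code N k C \<longleftrightarrow> VectorSpace.subspace class_ring C (module_vec TYPE('a) N) \<and> code_dim N C = k"

definition galois_inner :: "nat \<Rightarrow> nat \<Rightarrow> 'a::field vec \<Rightarrow> 'a vec \<Rightarrow> 'a" where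
  "galois_inner p l x y = (\<Sum>i<dim_vec x. x $ i * (y $ i) ^ (p ^ l))"

definition galois_dual :: "nat \<Rightarrow> nat \<Rightarrow> nat \<Rightarrow> 'a::field vec set \<Rightarrow> 'a vec set" where
  "galois_dual p l N C = {x \<in> carrier_vec N. \<forall>c\<in>C. galois_inner p l c x = 0}"

definition galois_hull :: "nat \<Rightarrow> nat \<Rightarrow> nat \<Rightarrow> 'a::field vec set \<Rightarrow> 'a vec set" where
  "galois_hull p l N C = C \<inter> galois_dual p l N C"

text \<open>\<open>transpose_mat A *\<^sub>v u\<close> is the row vector \<open>u\<close> times \<open>A\<close>. Since \<open>degree 0 = 0\<close>, the bound
  \<open>degree f < k\<close> includes the zero polynomial for \<open>k \<ge> 1\<close>.\<close>

definition GRL ::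
  "nat \<Rightarrow> nat \<Rightarrow> nat \<Rightarrow> 'a::field vec \<Rightarrow> 'a vec \<Rightarrow> 'a mat \<Rightarrow> 'a vec set" where
  "GRL n s k a v A =
     {vec n (\<lambda>i. v $ i * poly f (a $ i)) @\<^sub>v
      (transpose_mat A *\<^sub>v vec s (\<lambda>j. coeff f (k - s + j))) | f. degree f < k}"

definition is_GRL_code :: "nat \<Rightarrow> nat \<Rightarrow> nat \<Rightarrow> 'a::field vec set \<Rightarrow> bool" where
  "is_GRL_code n s k C \<longleftrightarrow> 1 \<le> s \<and> s \<le> k \<and> k \<le> n \<and>
     (\<exists>a v A. a \<in> carrier_vec n \<and> inj_on (($) a) {..<n} \<and>
        v \<in> carrier_vec n \<and> (\<forall>i<n. v $ i \<noteq> 0) \<and>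
        A \<in> carrier_mat s s \<and> invertible_mat A \<and>
        C = GRL n s k a v A)"

end

theory Submission
  imports Defs
begin

text \<open>Let \<open>Q = p ^ l\<close> and take the identity matrix for \<open>A\<close>. The evaluation
  points are the \<open>x\<close> whose norm \<open>x ^ ((q - 1) / (Q - 1))\<close> lies in a set
  \<open>T\<close> of \<open>t\<close> nonzero elements of the subfield with \<open>Q\<close> elements.
  Lagrange interpolation at \<open>0\<close> over \<open>T\<close> gives nonzero weights
  \<open>w\<^sub>i\<close> in that subfield with \<open>\<Sum> w\<^sub>i F(a\<^sub>i) = F(0)\<close> whenever
  \<open>degree F < n\<close>, and \<open>w\<^sub>i\<close> is a \<open>(Q + 1)\<close>-st power because the
  ground field contains the field with \<open>Q\<^sup>2\<close> elements. Scaling \<open>r = k - s - 1 -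
  h\<close> of the resulting column multipliers by \<open>\<alpha>\<close> with \<open>\<beta> = \<alpha> ^ (Q
  + 1) \<noteq> 1\<close>, the form on message polynomials becomes \<open>f(0) g(0)^Q + (\<beta> - 1)
  (\<Sum>i<r. w\<^sub>i f(a\<^sub>i) g(a\<^sub>i)^Q) + (\<Sum>j\<ge>k - s. f\<^sub>j g\<^sub>j^Q)\<close>. The
  functionals occurring in it are linearly independent, so the hull consists of the \<open>g\<close> of degree
  below \<open>k - s\<close> divisible by \<open>x \<Prod>(x - a\<^sub>i)\<close>, a space of dimension
  \<open>h\<close>.\<close>

section \<open>Power maps on a finite field\<close>

text \<open>Translation by 1 permutes the field, so adding 1 to every summand leaves the sum of all
  elements unchanged.\<close>

lemma of_nat_card_UNIV_eq_0: "of_nat (card (UNIV :: 'a::{field,finite} set)) = (0 :: 'a)"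
proof -
  have "(\<Sum>x\<in>(UNIV::'a set). x + 1) = (\<Sum>x\<in>UNIV. x)"
    by (rule sum.reindex_bij_witness[of _ "\<lambda>x. x - 1" "\<lambda>x. x + 1"]) auto
  then show ?thesis by (simp add: sum.distrib)
qed

lemma CHAR_eq_of_card_prime_power:
  assumes "prime p" and "card (UNIV :: 'a::{field,finite} set) = p ^ e"
  shows "CHAR('a) = p"
proof -
  have "of_nat p ^ e = (0 :: 'a)"
    using of_nat_card_UNIV_eq_0[where 'a = 'a] assms(2) by simp
  then have "of_nat p = (0 :: 'a)" by simp
  then have "CHAR('a) dvd p" by (simp add: of_nat_eq_0_iff_char_dvd)
  moreover have "CHAR('a) \<noteq> 1" by simp
  ultimately show ?thesis using assms(1) by (metis prime_nat_iff)
qed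

text \<open>Multiplication by \<open>x\<close> permutes the nonzero elements, whose product is
  nonzero and can be cancelled.\<close>

lemma power_card_UNIV_minus_1:
  fixes x :: "'a::{field,finite}"
  assumes "x \<noteq> 0"
  shows "x ^ (card (UNIV :: 'a set) - 1) = 1"
proof -
  have "(\<Prod>y\<in>UNIV-{0}. x * y) = (\<Prod>y\<in>UNIV-{0}. y)"
    using assms by (intro prod.reindex_bij_witness[of _ "\<lambda>y. y / x" "\<lambda>y. x * y"]) auto
  moreover have "(\<Prod>y\<in>UNIV-{0::'a}. y) \<noteq> 0" by simp
  ultimately show ?thesis by (simp add: prod.distrib card_Diff_singleton)
qed

lemma card_power_eq_le:
  fixes c :: "'a::idom"
  assumes "m > 0"
  shows "card {x. x ^ m = c} \<le> m"
proof -
  let ?p = "monom 1 m - [:c:]"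
  have "coeff ?p m = 1" using assms by (simp add: coeff_pCons split: nat.split)
  then have "?p \<noteq> 0" by (metis coeff_0 zero_neq_one)
  then have "card {x. poly ?p x = 0} \<le> degree ?p" by (rule card_poly_roots_bound)
  moreover have "degree ?p \<le> m" by (intro degree_diff_le) (auto simp: degree_monom_le)
  ultimately show ?thesis by (simp add: poly_monom)
qed

text \<open>The fibres of \<open>x \<mapsto> x ^ A\<close> have at most \<open>A\<close> elements and lie over at most \<open>B\<close> points, so a
  single deficient fibre would contradict \<open>card UNIV - 1 = A * B\<close>.\<close>

lemma card_power_eq:
  fixes b :: "'a::{field,finite}"
  assumes q: "card (UNIV :: 'a set) - 1 = A * B" and pos: "A > 0" "B > 0" and b: "b ^ B = 1"
  shows "card {x. x ^ A = b} = A"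
proof (rule ccontr)
  assume "card {x. x ^ A = b} \<noteq> A"
  then have less: "card {x. x ^ A = b} < A" using card_power_eq_le[OF pos(1), of b] by simp
  let ?R = "{c :: 'a. c ^ B = 1}"
  have "UNIV - {0} \<subseteq> (\<Union>c\<in>?R. {x. x ^ A = c})"
    using power_card_UNIV_minus_1[where 'a = 'a] unfolding q by (auto simp: power_mult)
  then have "A * B \<le> card (\<Union>c\<in>?R. {x. x ^ A = c})"
    using card_mono[of "\<Union>c\<in>?R. {x. x ^ A = c}" "UNIV - {0}"] q
    by (simp add: card_Diff_singleton)
  also have "\<dots> \<le> (\<Sum>c\<in>?R. card {x. x ^ A = c})" by (rule card_UN_le) simp
  also have "\<dots> < (\<Sum>c\<in>?R. A)"
    using less b card_power_eq_le[OF pos(1)] by (intro sum_strict_mono_ex1) auto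
  also have "\<dots> \<le> A * B" using card_power_eq_le[OF pos(2), of "1::'a"] by simp
  finally show False by simp
qed

text \<open>Multiplication by an \<open>A\<close>-th root of unity \<open>z\<close> permutes the
  fibre and scales the sum by \<open>z ^ r\<close>, so a \<open>z\<close> with
  \<open>z ^ r \<noteq> 1\<close> forces the sum to vanish.\<close>

lemma sum_power_over_fibre_eq_0:
  fixes b :: "'a::{field,finite}"
  assumes q: "card (UNIV :: 'a set) - 1 = A * B" and pos: "A > 0" "B > 0"
    and r: "\<not> A dvd r"
  shows "(\<Sum>x | x ^ A = b. x ^ r) = 0"
proof -
  have r0: "r mod A > 0" using r by (simp add: dvd_eq_mod_eq_0)
  \<comment> \<open>There are exactly \<open>A\<close> solutions of \<open>z ^ A = 1\<close>, but at
    most \<open>r mod A < A\<close> solutions of \<open>z ^ (r mod A) = 1\<close>; hence some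
    \<open>z\<close> solves only the former.\<close>
  have "card {z :: 'a. z ^ (r mod A) = 1} < card {z :: 'a. z ^ A = 1}"
    using card_power_eq_le[OF r0, of "1::'a"] card_power_eq[OF q pos, of 1] pos
    by (simp add: le_less_trans)
  then have "\<not> {z :: 'a. z ^ A = 1} \<subseteq> {z. z ^ (r mod A) = 1}"
    using card_mono[of "{z :: 'a. z ^ (r mod A) = 1}" "{z. z ^ A = 1}"] by auto
  then obtain z :: 'a where z: "z ^ A = 1" "z ^ (r mod A) \<noteq> 1" by auto
  have "z ^ r = (z ^ A) ^ (r div A) * z ^ (r mod A)"
    by (simp flip: power_mult power_add)
  with z have zr: "z ^ r \<noteq> 1" by simp
  have z0: "z \<noteq> 0" using z pos by (auto simp: power_0_left)
  let ?S = "\<Sum>x | x ^ A = b. x ^ r"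
  have "(\<Sum>x | x ^ A = b. (z * x) ^ r) = ?S"
    using z0 z by (intro sum.reindex_bij_witness[of _ "\<lambda>x. x / z" "\<lambda>x. z * x"])
      (auto simp: power_mult_distrib power_divide)
  then have "z ^ r * ?S = ?S" by (simp add: power_mult_distrib sum_distrib_left)
  then show ?thesis using zr by simp
qed

section \<open>Interpolation at 0 and weighted sums over norm fibres\<close>

text \<open>Value at 0 of the Lagrange basis polynomial of the node \<open>b\<close> among the nodes
  \<open>T\<close>.\<close>

definition lagrange_weight :: "'a::field set \<Rightarrow> 'a \<Rightarrow> 'a" where
  "lagrange_weight T b = (\<Prod>c\<in>T-{b}. c / (c - b))"

lemma sum_lagrange_weight:
  fixes G :: "'a::field poly"
  assumes T: "finite T" and G: "degree G < card T"
  shows "(\<Sum>b\<in>T. lagrange_weight T b * poly G b) = poly G 0"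
proof -
  \<comment> \<open>\<open>N b\<close> is the Lagrange basis polynomial, with factors
    \<open>(c - x) / (c - b)\<close>, so \<open>L\<close> interpolates \<open>G\<close> on
    \<open>T\<close>; degrees below \<open>card T\<close> then force \<open>G = L\<close>.\<close>
  define N where "N b = (\<Prod>c\<in>T-{b}. [:c / (c - b), - 1 / (c - b):])" for b
  define L where "L = (\<Sum>b\<in>T. Polynomial.smult (poly G b) (N b))"
  have deg: "degree (N b) < card T" if "b \<in> T" for b
  proof -
    have "degree (N b) \<le> (\<Sum>c\<in>T-{b}. 1)"
      unfolding N_def using T by (intro degree_prod_sum_le[THEN order_trans] sum_mono) auto
    also have "\<dots> < card T" using card_Diff1_less[OF T that] by simp
    finally show ?thesis .
  qed
  have "degree L < card T"
    unfolding L_def using G deg by (intro degree_sum_less) (auto intro: le_less_trans[OF degree_smult_le])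
  then have "degree (G - L) < card T" using G by (rule degree_diff_less[rotated])
  moreover have "poly (G - L) x = 0" if x: "x \<in> T" for x
  proof -
    have "poly (N b) x = (if b = x then 1 else 0)" if "b \<in> T" for b
      using x that T by (auto simp: N_def poly_prod simp flip: diff_divide_distrib intro!: prod.neutral)
    then have "poly L x = (\<Sum>b\<in>T. if b = x then poly G b else 0)"
      unfolding L_def by (auto simp: poly_sum intro!: sum.cong)
    then show ?thesis using T x by simp
  qed
  ultimately have "G = L"
    using card_poly_roots_bound[of "G - L"] card_mono[of "{x. poly (G - L) x = 0}" T] poly_roots_finite[of "G - L"]
    by (metis (mono_tags, lifting) eq_iff_diff_eq_0 leD le_trans mem_Collect_eq subsetI)
  then have "poly G 0 = poly L 0" by simp
  also have "\<dots> = (\<Sum>b\<in>T. lagrange_weight T b * poly G b)"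
    unfolding L_def N_def lagrange_weight_def by (simp add: poly_sum poly_prod mult.commute)
  finally show ?thesis by simp
qed

text \<open>In prime characteristic the map \<open>x \<mapsto> x ^ Q\<close> is a ring homomorphism;
  fixing \<open>b\<close> and \<open>c\<close>, it fixes each factor
  \<open>c / (c - b)\<close>.\<close>

lemma lagrange_weight_fixed_by_Frobenius:
  fixes T :: "'a::{field,finite} set"
  assumes "prime CHAR('a)" and Q: "Q = CHAR('a) ^ l" and T: "\<And>c. c \<in> T \<Longrightarrow> c ^ Q = c" and b: "b \<in> T"
  shows "lagrange_weight T b ^ Q = lagrange_weight T b"
proof -
  have "(c - b) ^ Q = c - b" if "c \<in> T" for c
    using freshmans_dream'[OF assms(1) Q, of "c - b" b] T[OF b] T[OF that]
    by (simp add: algebra_simps)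
  then show ?thesis unfolding lagrange_weight_def
    by (auto simp: prod_power_distrib power_divide T intro!: prod.cong)
qed

text \<open>By linearity only monomials \<open>x ^ r\<close> matter. Fibre sums kill exponents not
  divisible by \<open>A\<close>; for \<open>r = A * m\<close> the fibre over \<open>b\<close> gives
  \<open>A * b ^ m = b ^ m\<close>, and interpolation over \<open>T\<close> finishes. This raises
  the admissible degree from below \<open>card T\<close> to below \<open>A * card T\<close>.\<close>

lemma sum_coset_weights:
  fixes F :: "'a::{field,finite} poly"
  assumes q: "card (UNIV :: 'a set) - 1 = A * B" and pos: "A > 0" "B > 0"
    and T: "\<And>b. b \<in> T \<Longrightarrow> b ^ B = 1" and A1: "of_nat A = (1 :: 'a)"
    and F: "degree F < A * card T"
  shows "(\<Sum>x | x ^ A \<in> T. lagrange_weight T (x ^ A) * poly F x) = poly F 0"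
proof -
  \<comment> \<open>\<open>0 ^ r\<close> is the value of \<open>x ^ r\<close> at 0;
    \<open>0 ^ 0 = 1\<close> covers the constant term.\<close>
  have mon: "(\<Sum>x | x ^ A \<in> T. lagrange_weight T (x ^ A) * x ^ r) = 0 ^ r"
    if r: "r < A * card T" for r
  proof -
    have fib: "(\<Sum>x | x ^ A = b. x ^ r) = (if A dvd r then b ^ (r div A) else 0)" if "b \<in> T" for b
    proof (cases "A dvd r")
      case True
      then obtain m where m: "r = A * m" by blast
      have "(\<Sum>x | x ^ A = b. x ^ r) = (\<Sum>x | x ^ A = b. b ^ m)"
        unfolding m by (intro sum.cong) (auto simp: power_mult)
      then show ?thesis using card_power_eq[OF q pos T[OF that]] A1 pos m by simp
    qed (use sum_power_over_fibre_eq_0[OF q pos] in simp)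
    have "(\<Sum>x | x ^ A \<in> T. lagrange_weight T (x ^ A) * x ^ r)
        = (\<Sum>b\<in>T. \<Sum>x | x \<in> {x. x ^ A \<in> T} \<and> x ^ A = b. lagrange_weight T (x ^ A) * x ^ r)"
      by (rule sum.group[symmetric]) auto
    also have "\<dots> = (\<Sum>b\<in>T. lagrange_weight T b * (\<Sum>x | x ^ A = b. x ^ r))"
      unfolding sum_distrib_left by (intro sum.cong) auto
    also have "\<dots> = (\<Sum>b\<in>T. lagrange_weight T b * (if A dvd r then b ^ (r div A) else 0))"
      using fib by simp
    also have "\<dots> = 0 ^ r"
    proof (cases "A dvd r")
      case True
      then obtain m where m: "r = A * m" by blast
      then have "m < card T" using r pos by simp
      then have "(\<Sum>b\<in>T. lagrange_weight T b * poly (monom 1 m) b) = poly (monom 1 m) 0"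
        by (intro sum_lagrange_weight) (auto simp: degree_monom_eq)
      then show ?thesis using m pos by (simp add: poly_monom power_0_left)
    next
      case False
      then have "r \<noteq> 0" by (metis dvd_0_right)
      with False show ?thesis by (simp add: power_0_left)
    qed
    finally show ?thesis .
  qed
  have "(\<Sum>x | x ^ A \<in> T. lagrange_weight T (x ^ A) * poly F x)
      = (\<Sum>r\<le>degree F. coeff F r * (\<Sum>x | x ^ A \<in> T. lagrange_weight T (x ^ A) * x ^ r))"
    unfolding poly_altdef sum_distrib_left
    by (subst sum.swap) (simp add: mult_ac)
  also have "\<dots> = poly F 0"
    unfolding poly_altdef using F by (intro sum.cong) (auto simp: mon)
  finally show ?thesis .
qed

section \<open>Dimensions of codes parametrised by polynomials\<close>

text \<open>Rank-nullity for \<open>L\<close>, whose kernel is trivial by injectivity.\<close>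

lemma code_dim_linear_image:
  fixes L :: "'a::field vec \<Rightarrow> 'a vec"
  assumes carrier: "\<And>u. u \<in> carrier_vec d \<Longrightarrow> L u \<in> carrier_vec N"
    and add: "\<And>u w. u \<in> carrier_vec d \<Longrightarrow> w \<in> carrier_vec d \<Longrightarrow> L (u + w) = L u + L w"
    and smult: "\<And>c u. u \<in> carrier_vec d \<Longrightarrow> L (c \<cdot>\<^sub>v u) = c \<cdot>\<^sub>v L u"
    and inj: "inj_on L (carrier_vec d)"
  shows "linear_code N d (L ` carrier_vec d)"
proof -
  interpret V: vec_space "TYPE('a)" d .
  interpret W: vec_space "TYPE('a)" N .
  interpret lm: linear_map class_ring "module_vec TYPE('a) d" "module_vec TYPE('a) N" L
    by (rule linear_map.intro[OF vec_vs vec_vs], rule mod_hom.intro[OF vec_module vec_module],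
        unfold_locales)
      (auto simp: LinearCombinations.module_hom_def module_vec_simps class_ring_simps carrier add smult)
  have im: "lm.imT = L ` carrier_vec d" by (simp add: lm.im_def)
  have "vectorspace.dim class_ring (module_vec TYPE('a) d\<lparr>carrier := lm.kerT\<rparr>) = 0"
    using lm.inj_imp_dim_ker0 inj by simp
  then show ?thesis
    using lm.rank_nullity V.dim_is_n lm.imT_is_subspace V.fin_dim
    unfolding linear_code_def code_dim_def im[symmetric] by simp
qed

definition poly_of_coeffs :: "'a::comm_ring_1 vec \<Rightarrow> 'a poly" where
  "poly_of_coeffs u = (\<Sum>i<dim_vec u. Polynomial.monom (u $ i) i)"

lemma coeff_poly_of_coeffs: "poly.coeff (poly_of_coeffs u) i = (if i < dim_vec u then u $ i else 0)"
  unfolding poly_of_coeffs_def by (simp add: coeff_sum)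

text \<open>The codeword of \<open>f\<close> when the matrix of the code is the identity. No degree
  bound is imposed, so this is a linear map on all polynomials.\<close>

definition grl_word :: "nat \<Rightarrow> nat \<Rightarrow> nat \<Rightarrow> 'a::field vec \<Rightarrow> 'a vec \<Rightarrow> 'a poly \<Rightarrow> 'a vec" where
  "grl_word n s k a v f = vec n (\<lambda>i. v $ i * poly f (a $ i)) @\<^sub>v vec s (\<lambda>j. poly.coeff f (k - s + j))"

lemma GRL_one: "GRL n s k a v (1\<^sub>m s) = {grl_word n s k a v f | f. degree f < k}"
proof -
  have "transpose_mat (1\<^sub>m s) *\<^sub>v vec s g = vec s g" for g :: "nat \<Rightarrow> 'a"
    using one_mult_mat_vec[of "vec s g" s] by simp
  then show ?thesis unfolding GRL_def grl_word_def by simp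
qed

lemma grl_word_carrier: "grl_word n s k a v f \<in> carrier_vec (n + s)"
  unfolding grl_word_def by simp

lemma grl_word_add: "grl_word n s k a v (f + g) = grl_word n s k a v f + grl_word n s k a v g"
  unfolding grl_word_def by (intro eq_vecI) (auto simp: algebra_simps index_append_vec)

lemma grl_word_smult: "grl_word n s k a v (Polynomial.smult c f) = c \<cdot>\<^sub>v grl_word n s k a v f"
  unfolding grl_word_def by (intro eq_vecI) (auto simp: algebra_simps index_append_vec)

text \<open>The evaluation coordinates already decide: a nonzero difference would have
  \<open>n\<close> roots but degree below \<open>n\<close>.\<close>

lemma grl_word_inj:
  assumes a: "inj_on (($) a) {..<n}" and v: "\<And>i. i < n \<Longrightarrow> v $ i \<noteq> 0"
    and deg: "degree f < n" "degree g < n"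
    and eq: "grl_word n s k a v f = grl_word n s k a v g"
  shows "f = g"
proof (rule ccontr)
  assume "f \<noteq> g"
  then have ne: "f - g \<noteq> 0" by simp
  have "poly (f - g) (a $ i) = 0" if i: "i < n" for i
    using arg_cong[OF eq, of "\<lambda>w. w $ i"] i v[OF i] by (simp add: grl_word_def index_append_vec)
  then have "(($) a) ` {..<n} \<subseteq> {x. poly (f - g) x = 0}" by auto
  then have "card ((($) a) ` {..<n}) \<le> card {x. poly (f - g) x = 0}"
    by (rule card_mono[OF poly_roots_finite[OF ne]])
  then have "n \<le> card {x. poly (f - g) x = 0}"
    using card_image[OF a] by simp
  also have "\<dots> \<le> degree (f - g)" by (rule card_poly_roots_bound[OF ne])
  also have "\<dots> < n" using deg by (rule degree_diff_less)
  finally show False by simp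
qed

text \<open>Serves twice: \<open>P = 1\<close> gives the code itself, a product of linear factors
  gives its hull. Bounding \<open>m\<close> by coefficients rather than by degree leaves exactly
  \<open>m = 0\<close> when \<open>d = 0\<close>, as a zero hull requires.\<close>

lemma linear_code_grl_multiples:
  assumes a: "inj_on (($) a) {..<n}" and v: "\<And>i. i < n \<Longrightarrow> v $ i \<noteq> 0"
    and P: "P \<noteq> 0" and d: "degree P + d \<le> n"
  shows "linear_code (n + s) d {grl_word n s k a v (P * m) | m. \<forall>i\<ge>d. poly.coeff m i = 0}"
proof -
  let ?L = "\<lambda>u. grl_word n s k a v (P * poly_of_coeffs u)"
  have deg: "degree (P * poly_of_coeffs u) < n" if "u \<in> carrier_vec d" "P * poly_of_coeffs u \<noteq> 0" for u
  proof -
    have "poly.coeff (poly_of_coeffs u) (degree (poly_of_coeffs u)) \<noteq> 0"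
      using that(2) by (intro leading_coeff_neq_0) auto
    then have "degree (poly_of_coeffs u) < d"
      using that(1) by (metis coeff_poly_of_coeffs carrier_vecD)
    then show ?thesis using that d by (simp add: degree_mult_eq)
  qed
  have "inj_on ?L (carrier_vec d)"
  proof (rule inj_onI)
    fix u w assume u: "u \<in> carrier_vec d" and w: "w \<in> carrier_vec d" and eq: "?L u = ?L w"
    have "P * poly_of_coeffs u = P * poly_of_coeffs w"
    \<comment> \<open>For \<open>n = 0\<close> not even the zero polynomial has degree below
      \<open>n\<close>; but then \<open>d = 0\<close> and both vectors are empty.\<close>
    proof (cases "n = 0")
      case True
      then show ?thesis using u w d by (simp add: poly_of_coeffs_def)
    next
      case False
      then have "degree (P * poly_of_coeffs u) < n" "degree (P * poly_of_coeffs w) < n"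
        using deg[OF u] deg[OF w] by (metis degree_0 gr0I)+
      then show ?thesis using grl_word_inj[OF a v _ _ eq] by blast
    qed
    then have "poly_of_coeffs u = poly_of_coeffs w" using P by simp
    then have "u $ i = w $ i" if "i < d" for i
      using that u w coeff_poly_of_coeffs[of u i] coeff_poly_of_coeffs[of w i] by simp
    then show "u = w" using u w by (intro eq_vecI) auto
  qed
  moreover have "poly_of_coeffs (u + w) = poly_of_coeffs u + poly_of_coeffs w"
    if "u \<in> carrier_vec d" "w \<in> carrier_vec d" for u w :: "'a vec"
    using that by (intro poly_eqI) (auto simp: coeff_poly_of_coeffs)
  moreover have "poly_of_coeffs (c \<cdot>\<^sub>v u) = Polynomial.smult c (poly_of_coeffs u)" for c and u :: "'a vec"
    by (intro poly_eqI) (auto simp: coeff_poly_of_coeffs)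
  ultimately have "linear_code (n + s) d (?L ` carrier_vec d)"
    by (intro code_dim_linear_image)
      (auto simp: grl_word_carrier grl_word_add grl_word_smult distrib_left)
  moreover have "?L ` carrier_vec d = {grl_word n s k a v (P * m) | m. \<forall>i\<ge>d. poly.coeff m i = 0}"
  proof (intro equalityI subsetI)
    fix x assume "x \<in> {grl_word n s k a v (P * m) | m. \<forall>i\<ge>d. poly.coeff m i = 0}"
    then obtain m where m: "x = grl_word n s k a v (P * m)" "\<forall>i\<ge>d. poly.coeff m i = 0" by blast
    have "poly_of_coeffs (vec d (poly.coeff m)) = m"
      using m(2) by (intro poly_eqI) (auto simp: coeff_poly_of_coeffs)
    then show "x \<in> ?L ` carrier_vec d" 
      using m(1) by (intro image_eqI[where x = "vec d (poly.coeff m)"]) simp_all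
  qed (auto simp: coeff_poly_of_coeffs)
  ultimately show ?thesis by simp
qed

section \<open>The Galois form on message polynomials and the hull\<close>

lemma galois_inner_grl_word:
  "galois_inner p l (grl_word n s k a v f) (grl_word n s k a v g) =
     (\<Sum>i<n. v $ i ^ (p ^ l + 1) * (poly f (a $ i) * poly g (a $ i) ^ (p ^ l))) +
     (\<Sum>j<s. poly.coeff f (k - s + j) * poly.coeff g (k - s + j) ^ (p ^ l))"
proof -
  have "(\<Sum>i<n + s. g i) = (\<Sum>i<n. g i) + (\<Sum>j<s. g (n + j))" for g :: "nat \<Rightarrow> 'a"
    by (induction s) (auto simp: add.assoc)
  then show ?thesis
    by (simp add: galois_inner_def grl_word_def index_append_vec power_mult_distrib algebra_simps)
qed

lemma prod_linear_dvd:
  fixes g :: "'a::field poly"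
  assumes "finite S" and "\<And>x. x \<in> S \<Longrightarrow> poly g x = 0"
  shows "(\<Prod>x\<in>S. [:-x, 1:]) dvd g"
  using assms
proof (induction S arbitrary: g rule: finite_induct)
  case (insert x S)
  from insert.prems have "[:-x, 1:] dvd g" by (simp add: poly_eq_0_iff_dvd)
  then obtain m where m: "g = [:-x, 1:] * m" by blast
  have "poly m y = 0" if "y \<in> S" for y
    using insert.prems[of y] insert.hyps that by (auto simp: m)
  then have "(\<Prod>x\<in>S. [:-x, 1:]) dvd m" by (rule insert.IH)
  then show ?case using insert.hyps by (simp add: m mult_dvd_mono del: mult_pCons_left)
qed simp

lemma minus_one_dvd_power_minus_one: "(x::nat) - 1 dvd x ^ m - 1"
proof (cases "x = 0")
  case False
  then have "int (x - 1) dvd int (x ^ m - 1)"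
    using power_diff_1_eq[of "int x" m] by (simp add: of_nat_diff)
  then show ?thesis by (simp only: int_dvd_int_iff)
qed (auto simp: power_0_left)

lemma poly_prod_linear_eq_0_iff:
  fixes x :: "'a::field"
  assumes "finite S"
  shows "poly (\<Prod>c\<in>S. [:-c, 1:]) x = 0 \<longleftrightarrow> x \<in> S"
  using assms by (auto simp: poly_prod)

lemma degree_prod_linear:
  fixes S :: "'a::field set"
  shows "degree (\<Prod>c\<in>S. [:-c, 1:]) = card S"
  by (simp add: degree_prod_eq_sum_degree)

text \<open>The form decouples into the value at 0, the values at the \<open>r\<close> scaled points
  and the top \<open>s\<close> coefficients. Suitable message polynomials \<open>f\<close> detect
  each of these quantities of \<open>g\<close> separately, so all of them vanish on the
  hull.\<close>

lemma galois_hull_GRL: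
  fixes a v :: "'a::field vec" and u :: "nat \<Rightarrow> 'a"
  assumes p: "p > 0" and a: "inj_on (($) a) {..<n}" and a0: "\<And>i. i < n \<Longrightarrow> a $ i \<noteq> 0"
    and u0: "\<And>i. i < n \<Longrightarrow> u i \<noteq> 0"
    and quad: "\<And>F. degree F < n \<Longrightarrow> (\<Sum>i<n. u i * poly F (a $ i)) = poly F 0"
    and v: "\<And>i. i < n \<Longrightarrow> v $ i ^ (p ^ l + 1) = (if i < r then \<beta> * u i else u i)"
    and \<beta>: "\<beta> \<noteq> 1" and r: "r + s < k" and k: "(k - 1) * (p ^ l + 1) < n"
  defines "P \<equiv> (\<Prod>c\<in>insert 0 (($) a ` {..<r}). [:-c, 1:])"
  shows "galois_hull p l (n + s) (GRL n s k a v (1\<^sub>m s)) =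
    {grl_word n s k a v (P * m) | m. \<forall>i\<ge>k - s - 1 - r. poly.coeff m i = 0}"
proof -
  let ?w = "grl_word n s k a v" and ?Q = "p ^ l"
  let ?S = "insert 0 (($) a ` {..<r})"
  have Q: "?Q > 0" using p by simp
  have "k - 1 \<le> (k - 1) * (?Q + 1)" by simp
  with k have "k \<le> n" by linarith
  with r have rn: "r < n" by simp
  have inj_r: "inj_on (($) a) {..<r}" using a rn by (auto intro: inj_on_subset)
  have P0: "P \<noteq> 0" unfolding P_def by simp
  have a0': "0 \<notin> ($) a ` {..<r}" using a0 rn by (metis imageE lessThan_iff less_trans)
  then have degP: "degree P = r + 1"
    unfolding P_def degree_prod_linear by (simp add: card_image[OF inj_r])
  \<comment> \<open>\<open>f * g ^ ?Q\<close> has degree at most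
    \<open>(k - 1) * (?Q + 1) < n\<close>, so \<open>quad\<close> collapses the sum with weights
    \<open>u\<close> to the value at 0; the first \<open>r\<close> columns leave the excess factor
    \<open>\<beta> - 1\<close>.\<close>
  have form: "galois_inner p l (?w f) (?w g) =
      poly f 0 * poly g 0 ^ ?Q + (\<Sum>i<r. (\<beta> - 1) * u i * (poly f (a $ i) * poly g (a $ i) ^ ?Q)) +
      (\<Sum>j<s. poly.coeff f (k - s + j) * poly.coeff g (k - s + j) ^ ?Q)"
    if f: "degree f < k" and g: "degree g < k" for f g
  proof -
    let ?x = "\<lambda>i. poly f (a $ i) * poly g (a $ i) ^ ?Q"
    have "degree (f * g ^ ?Q) \<le> degree f + degree g * ?Q"
      by (intro degree_mult_le[THEN order_trans] add_left_mono degree_power_le)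
    also have "\<dots> \<le> (k - 1) + (k - 1) * ?Q" using f g by (intro add_mono mult_right_mono) auto
    also have "\<dots> < n" using k by (simp add: algebra_simps)
    finally have "(\<Sum>i<n. u i * ?x i) = poly f 0 * poly g 0 ^ ?Q"
      using quad[of "f * g ^ ?Q"] by (simp add: poly_power)
    moreover have "(\<Sum>i<n. v $ i ^ (?Q + 1) * ?x i)
        = (\<Sum>i<n. u i * ?x i) + (\<Sum>i<n. if i < r then (\<beta> - 1) * u i * ?x i else 0)"
      unfolding sum.distrib[symmetric] using v by (intro sum.cong) (auto simp: algebra_simps)
    moreover have "(\<Sum>i<n. if i < r then (\<beta> - 1) * u i * ?x i else 0) = (\<Sum>i<r. (\<beta> - 1) * u i * ?x i)"
      using rn by (intro sum.mono_neutral_cong_right) auto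
    ultimately show ?thesis unfolding galois_inner_grl_word by simp
  qed
  have GRL: "GRL n s k a v (1\<^sub>m s) = {?w f | f. degree f < k}" by (rule GRL_one)
  show ?thesis
  proof (intro equalityI subsetI)
    fix x assume "x \<in> {?w (P * m) | m. \<forall>i\<ge>k - s - 1 - r. poly.coeff m i = 0}"
    then obtain m where x: "x = ?w (P * m)" and m: "\<forall>i\<ge>k - s - 1 - r. poly.coeff m i = 0" by blast
    let ?g = "P * m"
    have deg: "degree ?g < k - s"
    proof (cases "m = 0")
      case False
      then have "degree m < k - s - 1 - r" using m leading_coeff_neq_0[OF False] by (metis not_le)
      then show ?thesis using False P0 degP r by (simp add: degree_mult_eq)
    qed (use r in simp)
    have root: "poly ?g c = 0" if "c \<in> ?S" for c
      using that poly_prod_linear_eq_0_iff[of ?S c] by (simp add: P_def)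
    have "galois_inner p l (?w f) (?w ?g) = 0" if "degree f < k" for f
    proof -
      have "degree ?g < k" using deg by simp
      moreover have "poly.coeff ?g (k - s + j) = 0" for j
        using deg by (intro coeff_eq_0) simp
      moreover have "poly ?g 0 = 0" "\<And>i. i < r \<Longrightarrow> poly ?g (a $ i) = 0"
        using root by auto
      ultimately show ?thesis using form[OF that, of ?g] Q by (simp del: poly_mult)
    qed
    then show "x \<in> galois_hull p l (n + s) (GRL n s k a v (1\<^sub>m s))"
      unfolding galois_hull_def galois_dual_def GRL x using deg
      by (auto simp: grl_word_carrier intro!: exI[of _ ?g])
  next
    fix x assume "x \<in> galois_hull p l (n + s) (GRL n s k a v (1\<^sub>m s))"
    then obtain g where x: "x = ?w g" and g: "degree g < k"
      and orth: "\<And>f. degree f < k \<Longrightarrow> galois_inner p l (?w f) (?w g) = 0"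
      unfolding galois_hull_def galois_dual_def GRL by blast
    have "poly g (a $ i) = 0" if i: "i < r" for i
    proof -
      \<comment> \<open>The test polynomial vanishes at 0 and at every scaled point except
        \<open>a $ i\<close>. Its degree \<open>r < k - s\<close> hides the top coefficients, so
        only the term of \<open>a $ i\<close> survives.\<close>
      let ?R = "insert 0 (($) a ` ({..<r} - {i}))"
      define f where "f = (\<Prod>c\<in>?R. [:-c, 1:])"
      have "card ?R = r"
        using a0' i card_image[OF inj_on_subset[OF inj_r, of "{..<r} - {i}"]]
        by (subst card_insert_disjoint) auto
      then have df: "degree f = r" unfolding f_def degree_prod_linear .
      then have "poly.coeff f (k - s + j) = 0" for j using r by (intro coeff_eq_0) simp
      moreover have froot: "poly f c = 0 \<longleftrightarrow> c \<in> ?R" for c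
        unfolding f_def by (rule poly_prod_linear_eq_0_iff) simp
      then have "poly f 0 = 0" by simp
      ultimately have "(\<Sum>j<r. (\<beta> - 1) * u j * (poly f (a $ j) * poly g (a $ j) ^ ?Q)) = 0"
        using form[of f g] orth[of f] df r g by simp
      moreover have "(\<Sum>j<r. (\<beta> - 1) * u j * (poly f (a $ j) * poly g (a $ j) ^ ?Q))
          = (\<Sum>j\<in>{i}. (\<beta> - 1) * u j * (poly f (a $ j) * poly g (a $ j) ^ ?Q))"
        using i froot by (intro sum.mono_neutral_right) auto
      moreover have "poly f (a $ i) \<noteq> 0"
        using froot[of "a $ i"] a0[of i] i rn inj_onD[OF inj_r, of i] by auto
      ultimately show ?thesis using \<beta> u0[of i] i rn Q by simp
    qed
    moreover have "poly g 0 = 0"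
    proof -
      \<comment> \<open>Test polynomial 1: the values of \<open>g\<close> at the scaled points are
        already 0, and \<open>k - s > 0\<close> keeps the top coefficients of 1 zero.\<close>
      have "poly.coeff 1 (k - s + j) = (0 :: 'a)" for j using r by (simp add: coeff_eq_0)
      then show ?thesis using form[of 1 g] orth[of 1] g r Q calculation by simp
    qed
    ultimately have root: "poly g c = 0" if "c \<in> ?S" for c using that by auto
    have high: "poly.coeff g i = 0" if i: "k - s \<le> i" for i
    proof (cases "i < k")
      case True
      \<comment> \<open>The monomial \<open>x ^ i\<close> singles out coefficient \<open>i\<close>,
        since \<open>g\<close> already vanishes on \<open>?S\<close>.\<close>
      define f :: "'a poly" where "f = Polynomial.monom 1 i"
      have "poly f 0 = 0" using i r by (simp add: f_def poly_monom power_0_left)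
      moreover have "degree f < k" using True by (simp add: f_def degree_monom_eq)
      moreover have "(\<Sum>j<s. poly.coeff f (k - s + j) * poly.coeff g (k - s + j) ^ ?Q)
          = (\<Sum>j\<in>{i - (k - s)}. poly.coeff f (k - s + j) * poly.coeff g (k - s + j) ^ ?Q)"
        using i True r by (intro sum.mono_neutral_right) (auto simp: f_def)
      ultimately have "poly.coeff f i * poly.coeff g i ^ ?Q = 0"
        using form[of f g] orth[of f] g root i Q by simp
      then show ?thesis by (simp add: f_def)
    qed (use g in \<open>simp add: coeff_eq_0\<close>)
    have "P dvd g" unfolding P_def using root by (intro prod_linear_dvd) auto
    then obtain m where m: "g = P * m" by blast
    have "poly.coeff m i = 0" if "k - s - 1 - r \<le> i" for i
    proof (cases "m = 0")
      case False
      then have "degree g < k - s"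
        using P0 high[of "degree g"] leading_coeff_neq_0[of g] m by (metis mult_eq_0_iff not_le)
      then show ?thesis
        using that False P0 degP m by (intro coeff_eq_0) (simp add: degree_mult_eq)
    qed simp
    then show "x \<in> {?w (P * m) | m. \<forall>i\<ge>k - s - 1 - r. poly.coeff m i = 0}"
      unfolding x m by blast
  qed
qed

section \<open>Evaluation points and their weights\<close>

lemma exists_grl_points:
  assumes p: "prime p" and card: "card (UNIV :: 'a::{field,finite} set) = p ^ e"
    and l: "l > 0" and e: "e > 0" "2 * l dvd e" and t: "t \<ge> 1" "t \<le> p ^ l - 1"
    and n: "n = t * ((p ^ e - 1) div (p ^ l - 1))"
  obtains a y :: "nat \<Rightarrow> 'a::{field,finite}" where "inj_on a {..<n}" "\<And>i. i < n \<Longrightarrow> a i \<noteq> 0" "\<And>i. i < n \<Longrightarrow> y i \<noteq> 0"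
    "\<And>F. degree F < n \<Longrightarrow> (\<Sum>i<n. y i ^ (p ^ l + 1) * poly F (a i)) = poly F 0"
proof -
  define Q where "Q = p ^ l"
  \<comment> \<open>\<open>A\<close> is the exponent of the norm to the subfield with
    \<open>Q\<close> elements, \<open>B\<close> the order of its multiplicative group.\<close>
  define A where "A = (p ^ e - 1) div (Q - 1)"
  define B where "B = Q - 1"
  obtain m where m: "e = 2 * l * m" using e by blast
  have Q2: "Q \<ge> 2"
    using prime_ge_2_nat[OF p] self_le_power[of p l] l by (simp add: Q_def)
  \<comment> \<open>Since \<open>2 * l\<close> divides \<open>e\<close>, the field size is a power
    of \<open>Q ^ 2\<close>; the resulting factor \<open>Q + 1\<close> is what makes the weights
    \<open>(Q + 1)\<close>-st powers.\<close>
  have "p ^ e = (Q ^ 2) ^ m" by (simp add: Q_def m mult_ac flip: power_mult)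
  moreover have "Q ^ 2 - 1 = (Q - 1) * (Q + 1)" by (simp add: algebra_simps power2_eq_square)
  ultimately have "(Q - 1) * (Q + 1) dvd p ^ e - 1"
    using minus_one_dvd_power_minus_one[of "Q ^ 2" m] by simp
  then obtain c where c: "p ^ e - 1 = (Q - 1) * (Q + 1) * c" by blast
  have "p ^ e > 1" using prime_gt_1_nat[OF p] e(1) by (rule one_less_power)
  then have c0: "c > 0" using c by (cases c) auto
  have A: "A = (Q + 1) * c" unfolding A_def c mult.assoc using Q2 by (subst nonzero_mult_div_cancel_left) auto
  have q: "card (UNIV :: 'a set) - 1 = A * B" unfolding card c A B_def by (simp only: mult_ac)
  have A0: "A > 0" and B0: "B > 0" using A c0 Q2 by (auto simp: B_def)
  have CHAR: "CHAR('a) = p" by (rule CHAR_eq_of_card_prime_power[OF p card])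
  have pz: "of_nat p = (0 :: 'a)" using CHAR by (metis of_nat_CHAR)
  \<comment> \<open>Both \<open>A * B = p ^ e - 1\<close> and \<open>B = Q - 1\<close> become
    \<open>-1\<close> in the field, hence \<open>A\<close> becomes 1.\<close>
  have "A * B + 1 = p ^ e" using q card \<open>p ^ e > 1\<close> by simp
  then have "of_nat (A * B) + 1 = (of_nat (p ^ e) :: 'a)" by (metis of_nat_1 of_nat_add)
  moreover have "of_nat B + 1 = (of_nat Q :: 'a)" using Q2 by (simp add: B_def of_nat_diff)
  ultimately have AB: "of_nat A * of_nat B + 1 = (0 :: 'a)" "of_nat B + 1 = (0 :: 'a)"
    using pz l e by (simp_all add: Q_def power_0_left)
  then have A1: "of_nat A = (1 :: 'a)" by (simp add: add_eq_0_iff2)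
  \<comment> \<open>The norms come from the \<open>Q - 1\<close> nonzero subfield elements, enough
    for \<open>t \<le> Q - 1\<close> of them. Each has \<open>A\<close> preimages, giving
    \<open>n = t * A\<close> points.\<close>
  have "card {b :: 'a. b ^ B = 1} = B"
    using card_power_eq[of B A "1::'a"] q A0 B0 by (simp add: mult.commute)
  then obtain T :: "'a set" where T: "T \<subseteq> {b. b ^ B = 1}" "card T = t"
    using t by (metis B_def Q_def obtain_subset_with_card_n)
  define X where "X = {x. x ^ A \<in> T}"
  have TB: "b ^ B = 1" if "b \<in> T" for b using T(1) that by auto
  have TQ: "b ^ Q = b" if "b \<in> T" for b
    using TB[OF that] Q2 power_Suc[of b B] by (simp add: B_def)
  have T0: "b \<noteq> 0" if "b \<in> T" for b using TB[OF that] B0 by (auto simp: power_0_left)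
  have "X = (\<Union>b\<in>T. {x. x ^ A = b})" by (auto simp: X_def)
  then have "card X = (\<Sum>b\<in>T. card {x. x ^ A = b})"
    by (simp only:) (rule card_UN_disjoint; auto)
  also have "\<dots> = n"
    using card_power_eq[OF q A0 B0 TB] by (simp add: T n A_def Q_def mult.commute)
  finally have cardX: "card X = n" .
  then obtain a where a: "bij_betw a {..<n} X"
    using ex_bij_betw_nat_finite[of X] by (auto simp: atLeast0LessThan)
  \<comment> \<open>A nonzero weight fixed by the \<open>Q\<close>-th power satisfies
    \<open>?w ^ B = 1\<close>. As \<open>p ^ e - 1 = (Q + 1) * (B * c)\<close>, the fibre of
    \<open>z \<mapsto> z ^ (Q + 1)\<close> over it has \<open>Q + 1\<close> elements.\<close>
  have "\<exists>z. z ^ (Q + 1) = lagrange_weight T b" if b: "b \<in> T" for b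
  proof -
    let ?w = "lagrange_weight T b"
    have "?w ^ Q = ?w"
      by (rule lagrange_weight_fixed_by_Frobenius[of Q l T b]) (use CHAR p Q_def TQ b in auto)
    moreover have "?w \<noteq> 0" using T0 by (auto simp: lagrange_weight_def)
    moreover have "?w ^ Q = ?w * ?w ^ B" using Q2 power_Suc[of ?w B] by (simp add: B_def)
    ultimately have "?w ^ B = 1" by simp
    then have "?w ^ (B * c) = 1" by (simp add: power_mult)
    moreover have "card (UNIV :: 'a set) - 1 = (Q + 1) * (B * c)"
      unfolding card c B_def by (simp only: mult_ac)
    ultimately have "card {z. z ^ (Q + 1) = ?w} = Q + 1"
      using c0 B0 by (intro card_power_eq) simp_all
    then have "{z. z ^ (Q + 1) = ?w} \<noteq> {}" by (metis card.empty add_is_0 one_neq_zero)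
    then show ?thesis by blast
  qed
  then obtain z where z: "\<And>b. b \<in> T \<Longrightarrow> z b ^ (Q + 1) = lagrange_weight T b" by metis
  show ?thesis
  proof (rule that[of a "\<lambda>i. z (a i ^ A)"])
    show "inj_on a {..<n}" using a by (rule bij_betw_imp_inj_on)
    fix i assume "i < n"
    then have aX: "a i ^ A \<in> T" using bij_betwE[OF a] by (auto simp: X_def)
    then show "a i \<noteq> 0" using T0[OF aX] A0 by (auto simp: power_0_left)
    have "lagrange_weight T (a i ^ A) \<noteq> 0" using T0 by (auto simp: lagrange_weight_def)
    then show "z (a i ^ A) \<noteq> 0" using z[OF aX] by (auto simp: power_0_left)
  next
    fix F :: "'a poly" assume F: "degree F < n"
    have "(\<Sum>i<n. z (a i ^ A) ^ (Q + 1) * poly F (a i))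
        = (\<Sum>x\<in>X. z (x ^ A) ^ (Q + 1) * poly F x)"
      by (rule sum.reindex_bij_betw[OF a])
    also have "\<dots> = (\<Sum>x\<in>X. lagrange_weight T (x ^ A) * poly F x)"
      using z by (intro sum.cong) (auto simp: X_def)
    also have "\<dots> = poly F 0"
      unfolding X_def using q A0 B0 TB A1
      by (rule sum_coset_weights) (use F T n in \<open>auto simp: A_def Q_def mult.commute\<close>)
    finally show "(\<Sum>i<n. z (a i ^ A) ^ (p ^ l + 1) * poly F (a i)) = poly F 0" by (simp add: Q_def)
  qed
qed

section \<open>Choice of the scaled columns and assembly of the code\<close>

theorem mainTheorem6:
  fixes p e l t n s k h :: nat
  assumes "prime p"
    and "card (UNIV :: 'a::{field,finite} set) = p ^ e"
    and "p ^ e > 4"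
    and "l > 0"
    and "2 * l dvd e"
    and "1 \<le> t" and "t \<le> p ^ l - 1"
    and "n = t * ((p ^ e - 1) div (p ^ l - 1))"
    and "s \<ge> 1"
    and "s + 1 \<le> k"
    and "int k \<le> \<lfloor>real (p ^ l + n) / real (p ^ l + 1)\<rfloor>"
    and "h \<le> k - s - 1"
  shows "\<exists>C :: 'a vec set.
           linear_code (n + s) k C \<and> is_GRL_code n s k C \<and>
           code_dim (n + s) (galois_hull p l (n + s) C) = h"
proof -
  let ?Q = "p ^ l"
  have e: "e > 0" using assms(3) by (cases e) auto
  obtain b y :: "nat \<Rightarrow> 'a" where b: "inj_on b {..<n}" "\<And>i. i < n \<Longrightarrow> b i \<noteq> 0"
    and y: "\<And>i. i < n \<Longrightarrow> y i \<noteq> 0"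
    and quad: "\<And>F. degree F < n \<Longrightarrow> (\<Sum>i<n. y i ^ (?Q + 1) * poly F (b i)) = poly F 0"
    using exists_grl_points[OF assms(1,2,4) e assms(5-8)] by blast
  have Q2: "?Q \<ge> 2"
    using prime_ge_2_nat[OF assms(1)] self_le_power[of p l] assms(4) by simp
  \<comment> \<open>The floor bound says \<open>k * (?Q + 1) \<le> ?Q + n\<close>, which is exactly
    the strict degree bound \<open>(k - 1) * (?Q + 1) < n\<close>.\<close>
  have "real k \<le> real (?Q + n) / real (?Q + 1)" using assms(11) by (simp add: le_floor_iff)
  moreover have "0 < real (?Q + 1)" by (simp only: of_nat_0_less_iff)
  ultimately have "real k * real (?Q + 1) \<le> real (?Q + n)" by (simp only: pos_le_divide_eq)
  then have "k * (?Q + 1) \<le> ?Q + n" by (simp only: of_nat_le_iff flip: of_nat_mult)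
  moreover have "k * (?Q + 1) = (k - 1) * (?Q + 1) + (?Q + 1)"
    using assms(10) by (cases k) auto
  ultimately have kn: "(k - 1) * (?Q + 1) < n" by simp
  have "k - 1 \<le> (k - 1) * (?Q + 1)" by simp
  with kn have k_le: "k \<le> n" by linarith
  \<comment> \<open>Zero and the solutions of \<open>x ^ (?Q + 1) = 1\<close> make up at most
    \<open>?Q + 2\<close> elements. The field is larger: by \<open>p ^ e > 4\<close> if
    \<open>?Q = 2\<close>, and by \<open>p ^ e \<ge> ?Q ^ 2 \<ge> 3 * ?Q\<close> otherwise.\<close>
  obtain \<alpha> :: 'a where \<alpha>: "\<alpha> \<noteq> 0" "\<alpha> ^ (?Q + 1) \<noteq> 1"
  proof -
    obtain m where m: "e = 2 * l * m" using assms(5) by blast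
    have q: "p ^ e = (?Q ^ 2) ^ m" by (simp add: m mult_ac flip: power_mult)
    have "?Q + 2 < p ^ e"
    proof (cases "?Q = 2")
      case True
      then show ?thesis using assms(3) by simp
    next
      case False
      then have "?Q + 2 < ?Q * 3" "?Q * 3 \<le> ?Q ^ 2" using Q2 by (auto simp: power2_eq_square)
      moreover have "?Q ^ 2 \<le> p ^ e" unfolding q using e m Q2 by (intro self_le_power) auto
      ultimately show ?thesis by linarith
    qed
    moreover have "card {x :: 'a. x ^ (?Q + 1) = 1} \<le> ?Q + 1" by (rule card_power_eq_le) simp
    ultimately have "card (insert 0 {x :: 'a. x ^ (?Q + 1) = 1}) < card (UNIV :: 'a set)"
      using card_insert_le_m1[of "?Q + 2" "{x :: 'a. x ^ (?Q + 1) = 1}" 0] assms(2) by simp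
    then have "insert 0 {x :: 'a. x ^ (?Q + 1) = 1} \<noteq> UNIV" by (metis less_irrefl_nat)
    then show ?thesis using that by blast
  qed
  \<comment> \<open>Without scaling the hull has dimension \<open>k - s - 1\<close>; each scaled
    column lowers it by one.\<close>
  define r where "r = k - s - 1 - h"
  define a where "a = vec n b"
  define v where "v = vec n (\<lambda>i. if i < r then \<alpha> * y i else y i)"
  define C where "C = GRL n s k a v (1\<^sub>m s)"
  define P where "P = (\<Prod>c\<in>insert 0 (($) a ` {..<r}). [:-c, 1:])"
  have ab: "a $ i = b i" if "i < n" for i using that by (simp add: a_def)
  have a: "inj_on (($) a) {..<n}" using b(1) ab by (simp add: inj_on_def)
  have v0: "v $ i \<noteq> 0" if "i < n" for i using that y \<alpha> by (simp add: v_def)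
  have "C = {grl_word n s k a v (1 * m) | m. \<forall>i\<ge>k. poly.coeff m i = 0}"
  proof -
    have "degree f < k \<longleftrightarrow> (\<forall>i\<ge>k. poly.coeff f i = 0)" for f :: "'a poly"
      using assms(10) by (cases "f = 0") (auto simp: coeff_eq_0 not_le[symmetric])
    then show ?thesis unfolding C_def GRL_one by simp
  qed
  then have code: "linear_code (n + s) k C"
    using linear_code_grl_multiples[OF a v0, of 1 k] k_le by simp
  have grl: "is_GRL_code n s k C"
    unfolding is_GRL_code_def
  proof (intro conjI exI)
    show "a \<in> carrier_vec n" "v \<in> carrier_vec n" by (simp_all add: a_def v_def)
    show "C = GRL n s k a v (1\<^sub>m s)" by (rule C_def)
    show "invertible_mat (1\<^sub>m s :: 'a mat)"
      by (auto simp: invertible_mat_def inverts_mat_def intro!: exI[of _ "1\<^sub>m s"])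
  qed (use assms(9,10) k_le a v0 in auto)
  have hull: "galois_hull p l (n + s) C =
      {grl_word n s k a v (P * m) | m. \<forall>i\<ge>k - s - 1 - r. poly.coeff m i = 0}"
    unfolding C_def P_def
  proof (rule galois_hull_GRL[where u = "\<lambda>i. y i ^ (?Q + 1)" and \<beta> = "\<alpha> ^ (?Q + 1)"])
    show "p > 0" using assms(1) by (rule prime_gt_0_nat)
    show "r + s < k" using assms(10) by (simp add: r_def)
    show "(\<Sum>i<n. y i ^ (?Q + 1) * poly F (a $ i)) = poly F 0" if "degree F < n" for F
      using quad[OF that] ab by simp
    show "v $ i ^ (?Q + 1) = (if i < r then \<alpha> ^ (?Q + 1) * y i ^ (?Q + 1) else y i ^ (?Q + 1))"
      if "i < n" for i using that by (simp add: v_def power_mult_distrib)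
  qed (use a b(2) ab y \<alpha> kn in auto)
  have "linear_code (n + s) (k - s - 1 - r)
      {grl_word n s k a v (P * m) | m. \<forall>i\<ge>k - s - 1 - r. poly.coeff m i = 0}"
  proof (rule linear_code_grl_multiples[OF a v0])
    have "card (insert 0 (($) a ` {..<r})) \<le> r + 1"
      using card_image_le[of "{..<r}" "($) a"] card_insert_le_m1[of "r + 1" "($) a ` {..<r}" 0] by simp
    then have "degree P \<le> r + 1" unfolding P_def degree_prod_linear .
    then show "degree P + (k - s - 1 - r) \<le> n" using k_le assms(9,10) by (simp add: r_def)
  qed (simp_all add: P_def)
  moreover have "k - s - 1 - r = h" using assms(12) by (simp add: r_def)
  ultimately have "code_dim (n + s) (galois_hull p l (n + s) C) = h"
    unfolding hull linear_code_def by simp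
  with code grl show ?thesis by blast
qed

end
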